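(* Let $\alpha\in\mathbb{R}$, let $f\in D_\alpha$ satisfy $f(0)\neq 0$, and let $n\ge 0$ be an integer. Let $p_n$ be the optimal approximant of order $n$ to $1/f$ in $D_\alpha$, let $M_n=\left(\langle z^jf,z^kf\rangle_\alpha\right)_{j,k=0}^n$, let $(\varphi_k)_{k\ge 0}$ be the orthogonal polynomials for the weighted space $D_{\alpha,f}$, and let $K_n$ be the reproducing kernel of the subspace $f\cdot\mathcal{P}_n\subset D_\alpha$. Then the following quantities are all equal: (a) $\mathrm{dist}^2_{D_\alpha}(1,f\cdot\mathcal{P}_n)$; (b) $\|p_nf-1\|_\alpha^2$; (c) $1-p_n(0)f(0)$; (d) $1-\left((M_n)^{-1}\right)_{0,0}|f(0)|^2$; (e) $1-\sum_{k=0}^n|\varphi_k(0)|^2|f(0)|^2$; (f) $1-K_n(0,0)$. If, moreover, $\alpha=0$ and the degree of $p_n$ is equal to $n$, then all six quantities (a)–(f) are also equal to $1-\hat{\varphi}_n(n)^2|f(0)|^2$, where $\hat{\varphi}_n(n)$ denotes the coefficient of $z^n$ in $\varphi_n$.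
   Context: $\mathbb{D}=\{z\in\mathbb{C}:|z|<1\}$. For $\alpha\in\mathbb{R}$, the Dirichlet-type space $D_\alpha$ consists of all analytic functions $f=\sum_{k\ge 0}a_kz^k$ on $\mathbb{D}$ with $\|f\|_\alpha^2=\sum_{k=0}^\infty (k+1)^\alpha|a_k|^2<\infty$; it is a Hilbert space with inner product $\langle f,g\rangle_\alpha=\sum_{k=0}^\infty (k+1)^\alpha a_k\overline{b_k}$ for $g=\sum_{k\ge0} b_kz^k$. Let $\mathcal{P}_n$ be the space of complex polynomials of degree at most $n$ and $f\cdot\mathcal{P}_n=\{pf:p\in\mathcal{P}_n\}$. The optimal approximant of order $n$ to $1/f$ (in $D_\alpha$) is the unique $p_n\in\mathcal{P}_n$ minimizing $\|pf-1\|_\alpha$ over all $p\in\mathcal{P}_n$. $\mathrm{dist}_{D_\alpha}(1,f\cdot\mathcal{P}_n)=\inf_{p\in\mathcal{P}_n}\|1-pf\|_\alpha$, and $\mathrm{dist}^2_{D_\alpha}$ is its square. The weighted space $D_{\alpha,f}$ has inner product $\langle\varphi,\psi\rangle_{\alpha,f}=\langle\varphi f,\psi f\rangle_\alpha$, and its orthogonal polynomials $(\varphi_k)_{k\ge0}$ are the unique polynomials such that $\varphi_k$ has degree exactly $k$ and positive leading coefficient and $\langle\varphi_kf,\varphi_jf\rangle_\alpha=\delta_{k,j}$ for all $k,j\ge0$. The reproducing kernel $K_n$ of $f\cdot\mathcal{P}_n$ is the function on $\mathbb{D}\times\mathbb{D}$ with $K_n(\cdot,w)\in f\cdot\mathcal{P}_n$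 and $g(w)=\langle g,K_n(\cdot,w)\rangle_\alpha$ for all $g\in f\cdot\mathcal{P}_n$, $w\in\mathbb{D}$; explicitly $K_n(z,w)=\sum_{k=0}^n\overline{\varphi_k(w)f(w)}\,\varphi_k(z)f(z)$. Rows and columns of $M_n$ are indexed from $0$ to $n$. *)

theory Defs
  imports
    "HOL-Complex_Analysis.Complex_Analysis"
    "HOL-Computational_Algebra.Polynomial"
    "Jordan_Normal_Form.Gauss_Jordan_Elimination"
begin

text \<open>
  Functions on the open unit disc are represented by total functions on \<open>complex\<close>; all notions
  below depend only on the values on \<open>ball 0 1\<close>.
\<close>

definition taylor_coeff :: "(complex \<Rightarrow> complex) \<Rightarrow> nat \<Rightarrow> complex" where
  "taylor_coeff f k = fps_nth (fps_expansion f 0) k"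

definition dirichlet_space :: "real \<Rightarrow> (complex \<Rightarrow> complex) set" where
  "dirichlet_space \<alpha> = {f. f analytic_on ball 0 1 \<and>
     summable (\<lambda>k. (real k + 1) powr \<alpha> * (cmod (taylor_coeff f k))\<^sup>2)}"

definition dirichlet_inner :: "real \<Rightarrow> (complex \<Rightarrow> complex) \<Rightarrow> (complex \<Rightarrow> complex) \<Rightarrow> complex" where
  "dirichlet_inner \<alpha> f g =
     (\<Sum>k. complex_of_real ((real k + 1) powr \<alpha>) * taylor_coeff f k * cnj (taylor_coeff g k))"

definition dirichlet_norm :: "real \<Rightarrow> (complex \<Rightarrow> complex) \<Rightarrow> real" where
  "dirichlet_norm \<alpha> f = sqrt (\<Sum>k. (real k + 1) powr \<alpha> * (cmod (taylor_coeff f k))\<^sup>2)"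

definition dirichlet_dist :: "real \<Rightarrow> (complex \<Rightarrow> complex) \<Rightarrow> (complex \<Rightarrow> complex) set \<Rightarrow> real" where
  "dirichlet_dist \<alpha> g S = (INF h\<in>S. dirichlet_norm \<alpha> (\<lambda>z. g z - h z))"

text \<open>The subspace \<open>f \<cdot> P\<^sub>n\<close>; membership is an equality of functions on the disc only.\<close>

definition poly_multiples :: "(complex \<Rightarrow> complex) \<Rightarrow> nat \<Rightarrow> (complex \<Rightarrow> complex) set" where
  "poly_multiples f n =
     {g. \<exists>p :: complex poly. degree p \<le> n \<and> (\<forall>z\<in>ball 0 1. g z = poly p z * f z)}"

definition is_optimal_approximant ::
  "real \<Rightarrow> (complex \<Rightarrow> complex) \<Rightarrow> nat \<Rightarrow> complex poly \<Rightarrow> bool" where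
  "is_optimal_approximant \<alpha> f n p \<longleftrightarrow> degree p \<le> n \<and>
     (\<forall>q. degree q \<le> n \<longrightarrow>
        dirichlet_norm \<alpha> (\<lambda>z. poly p z * f z - 1) \<le> dirichlet_norm \<alpha> (\<lambda>z. poly q z * f z - 1))"

definition gram_matrix :: "real \<Rightarrow> (complex \<Rightarrow> complex) \<Rightarrow> nat \<Rightarrow> complex Matrix.mat" where
  "gram_matrix \<alpha> f n = Matrix.mat (n + 1) (n + 1)
     (\<lambda>(j, k). dirichlet_inner \<alpha> (\<lambda>z. z ^ j * f z) (\<lambda>z. z ^ k * f z))"

definition weighted_inner ::
  "real \<Rightarrow> (complex \<Rightarrow> complex) \<Rightarrow> (complex \<Rightarrow> complex) \<Rightarrow> (complex \<Rightarrow> complex) \<Rightarrow> complex" where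
  "weighted_inner \<alpha> f \<phi> \<psi> = dirichlet_inner \<alpha> (\<lambda>z. \<phi> z * f z) (\<lambda>z. \<psi> z * f z)"

definition is_orthogonal_polynomials ::
  "real \<Rightarrow> (complex \<Rightarrow> complex) \<Rightarrow> (nat \<Rightarrow> complex poly) \<Rightarrow> bool" where
  "is_orthogonal_polynomials \<alpha> f \<phi> \<longleftrightarrow>
     (\<forall>k. degree (\<phi> k) = k \<and> lead_coeff (\<phi> k) \<in> \<real> \<and> Re (lead_coeff (\<phi> k)) > 0) \<and>
     (\<forall>k j. weighted_inner \<alpha> f (poly (\<phi> k)) (poly (\<phi> j)) = (if k = j then 1 else 0))"

definition is_reproducing_kernel ::
  "real \<Rightarrow> (complex \<Rightarrow> complex) set \<Rightarrow> (complex \<Rightarrow> complex \<Rightarrow> complex) \<Rightarrow> bool" where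
  "is_reproducing_kernel \<alpha> S K \<longleftrightarrow>
     (\<forall>w\<in>ball 0 1. (\<lambda>z. K z w) \<in> S \<and> (\<forall>g\<in>S. g w = dirichlet_inner \<alpha> g (\<lambda>z. K z w)))"

end

theory Submission
  imports Defs "Jordan_Normal_Form.Determinant"
begin

text \<open>
  Expanding a polynomial of degree at most \<open>n\<close> in the orthonormal system \<open>\<phi>\<close> shows that the
  functional \<open>q \<mapsto> q(0) f(0)\<close> is represented by
  \<open>p\<^sup>* = (\<Sum>k\<le>n. cnj (\<phi>\<^sub>k(0) f(0)) \<phi>\<^sub>k)\<close>. Completing the square,
  \<open>\<parallel>q f - 1\<parallel>\<^sup>2 = \<parallel>(q - p\<^sup>*) f\<parallel>\<^sup>2 + 1 - p\<^sup>*(0) f(0)\<close>, so \<open>p\<^sup>*\<close> is the optimal approximant,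
  \<open>p\<^sup>* f\<close> is the kernel at \<open>0\<close>, and the Gram matrix is inverted by the matrix of coefficients of
  the kernel. For \<open>\<alpha> = 0\<close> multiplication by \<open>z\<close> is isometric, so the representing polynomial is
  also a multiple of the reversed polynomial of \<open>\<phi>\<^sub>n\<close>.
\<close>

lemma of_real_cmod_squared: "(complex_of_real (cmod z))\<^sup>2 = z * cnj z"
  using complex_norm_square[of z] by simp

section \<open>Orthonormal polynomials of a Hermitian form\<close>

text \<open>The form lives on polynomials, so the extremal problem becomes finite-dimensional
  algebra; series enter only through the instance \<open>weighted_inner\<close>. Positive
  definiteness comes from the orthonormal system, see \<open>form_eq_0\<close>.\<close>

locale orthonormal_polys =
  fixes B :: "complex poly \<Rightarrow> complex poly \<Rightarrow> complex" and \<phi> :: "nat \<Rightarrow> complex poly"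
  assumes add_left: "B (p + q) r = B p r + B q r"
    and smult_left: "B (Polynomial.smult c p) r = c * B p r"
    and hermitian: "B p q = cnj (B q p)"
    and degree_phi: "degree (\<phi> k) = k"
    and phi_nonzero: "\<phi> k \<noteq> 0"
    and orthonormal: "B (\<phi> k) (\<phi> j) = (if k = j then 1 else 0)"
begin

section \<open>Sesquilinearity, expansion in the orthonormal system, definiteness\<close>

lemma add_right: "B r (p + q) = B r p + B r q"
  by (metis add_left hermitian complex_cnj_add)

lemma smult_right: "B r (Polynomial.smult c p) = cnj c * B r p"
  by (metis smult_left hermitian complex_cnj_mult)

lemma zero_left [simp]: "B 0 r = 0"
  using smult_left[of 0 0 r] by simp

lemma zero_right [simp]: "B r 0 = 0"
  using smult_right[of r 0 0] by simp

lemma diff_left: "B (p - q) r = B p r - B q r"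
  using add_left[of "p - q" q r] by simp

lemma diff_right: "B r (p - q) = B r p - B r q"
  using add_right[of r "p - q" q] by simp

lemma sum_left: "B (\<Sum>k\<in>A. g k) r = (\<Sum>k\<in>A. B (g k) r)"
  by (induction A rule: infinite_finite_induct) (simp_all add: add_left)

lemma sum_right: "B r (\<Sum>k\<in>A. g k) = (\<Sum>k\<in>A. B r (g k))"
  by (induction A rule: infinite_finite_induct) (simp_all add: add_right)

text \<open>There is one \<open>\<phi> k\<close> in each degree, so subtracting a multiple of
  \<open>\<phi> (Suc n)\<close> that cancels the top coefficient lowers the degree.\<close>

lemma phi_spans:
  assumes "degree q \<le> n"
  shows "\<exists>a. q = (\<Sum>k\<le>n. Polynomial.smult (a k) (\<phi> k))"
  using assms
proof (induction n arbitrary: q)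
  case 0
  obtain c d where c: "q = [:c:]" and d: "\<phi> 0 = [:d:]"
    using 0 degree_phi[of 0] by (metis le_zero_eq degree_eq_zeroE)
  have "d \<noteq> 0"
    using phi_nonzero[of 0] d by auto
  then show ?case
    by (intro exI[of _ "\<lambda>_. c / d"]) (simp add: c d)
next
  case (Suc n)
  have lead: "coeff (\<phi> (Suc n)) (Suc n) \<noteq> 0"
    using phi_nonzero[of "Suc n"] degree_phi[of "Suc n"] by (metis leading_coeff_0_iff)
  define b where "b = coeff q (Suc n) / coeff (\<phi> (Suc n)) (Suc n)"
  have "degree (q - Polynomial.smult b (\<phi> (Suc n))) \<le> n"
  proof (rule degree_le, intro allI impI)
    fix i assume "n < i"
    then consider "i = Suc n" | "Suc n < i" by linarith
    then show "coeff (q - Polynomial.smult b (\<phi> (Suc n))) i = 0"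
    proof cases
      case 1
      then show ?thesis using lead by (simp add: b_def)
    next
      case 2
      then show ?thesis using Suc.prems degree_phi[of "Suc n"] by (simp add: coeff_eq_0)
    qed
  qed
  from Suc.IH[OF this] obtain a where
    a: "q - Polynomial.smult b (\<phi> (Suc n)) = (\<Sum>k\<le>n. Polynomial.smult (a k) (\<phi> k))" by blast
  have "(\<Sum>k\<le>n. Polynomial.smult ((a(Suc n := b)) k) (\<phi> k)) = (\<Sum>k\<le>n. Polynomial.smult (a k) (\<phi> k))"
    by (rule sum.cong) auto
  then have "q = (\<Sum>k\<le>Suc n. Polynomial.smult ((a(Suc n := b)) k) (\<phi> k))"
    using a by (simp add: algebra_simps)
  then show ?case by blast
qed

text \<open>Pairing any expansion with \<open>\<phi> k\<close> isolates its \<open>k\<close>-th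
  coefficient.\<close>

lemma expansion:
  assumes "degree q \<le> n"
  shows "q = (\<Sum>k\<le>n. Polynomial.smult (B q (\<phi> k)) (\<phi> k))"
proof -
  obtain a where a: "q = (\<Sum>k\<le>n. Polynomial.smult (a k) (\<phi> k))"
    using phi_spans[OF assms] by blast
  have "B q (\<phi> k) = a k" if "k \<le> n" for k
  proof -
    have "B q (\<phi> k) = (\<Sum>j\<le>n. a j * (if j = k then 1 else 0))"
      by (subst a) (simp add: sum_left smult_left orthonormal)
    also have "\<dots> = a k" using that by (simp add: if_distrib cong: if_cong)
    finally show ?thesis .
  qed
  then show ?thesis
    by (subst a) (intro sum.cong, auto)
qed

lemma parseval:
  assumes "degree q \<le> n"
  shows "B q q = of_real (\<Sum>k\<le>n. (cmod (B q (\<phi> k)))\<^sup>2)"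
proof -
  have "B q q = B q (\<Sum>k\<le>n. Polynomial.smult (B q (\<phi> k)) (\<phi> k))"
    using expansion[OF assms] by simp
  also have "\<dots> = (\<Sum>k\<le>n. B q (\<phi> k) * cnj (B q (\<phi> k)))"
    unfolding sum_right smult_right by (simp add: mult.commute)
  finally show ?thesis
    by (simp add: of_real_cmod_squared)
qed

text \<open>By Parseval a nonpositive form value forces all Fourier coefficients to vanish. The
  hypothesis is an inequality because comparison with a minimizer yields one.\<close>

lemma form_eq_0:
  assumes "Re (B q q) \<le> 0"
  shows "q = 0"
proof -
  have "(\<Sum>k\<le>degree q. (cmod (B q (\<phi> k)))\<^sup>2) = 0"
    using parseval[OF order_refl, of q] assms
    by (intro antisym) (auto intro: sum_nonneg)
  then have "B q (\<phi> k) = 0" if "k \<le> degree q" for k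
    using that by (simp add: sum_nonneg_eq_0_iff)
  then show ?thesis
    by (subst expansion[OF order_refl, of q]) simp
qed

section \<open>The representing polynomial of evaluation at 0\<close>

text \<open>The Riesz representative, in degree at most \<open>n\<close>, of the functional q ->
  q(0) c; the parameter \<open>c\<close> will be f(0).\<close>

definition rep :: "nat \<Rightarrow> complex \<Rightarrow> complex poly" where
  "rep n c = (\<Sum>k\<le>n. Polynomial.smult (cnj (poly (\<phi> k) 0 * c)) (\<phi> k))"

lemma degree_rep: "degree (rep n c) \<le> n"
  unfolding rep_def using degree_phi
  by (intro degree_sum_le) (auto intro: order_trans[OF degree_smult_le])

lemma rep_represents:
  assumes "degree q \<le> n"
  shows "B q (rep n c) = poly q 0 * c"
proof -
  have "B q (rep n c) = (\<Sum>k\<le>n. B q (\<phi> k) * poly (\<phi> k) 0) * c"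
    by (simp add: rep_def sum_right smult_right sum_distrib_left mult_ac)
  also have "(\<Sum>k\<le>n. B q (\<phi> k) * poly (\<phi> k) 0) = poly q 0"
    by (subst (2) expansion[OF assms]) (simp add: poly_sum)
  finally show ?thesis .
qed

text \<open>The difference of two representatives is orthogonal to all polynomials of degree at most
  \<open>n\<close>, hence to itself. This identifies both the kernel section at 0 and the reversed
  polynomial with \<open>rep\<close>.\<close>

lemma rep_unique:
  assumes "degree r \<le> n" and "\<And>q. degree q \<le> n \<Longrightarrow> B q r = poly q 0 * c"
  shows "r = rep n c"
proof -
  have "degree (r - rep n c) \<le> n"
    using assms(1) degree_rep by (rule degree_diff_le)
  then have "B (r - rep n c) (r - rep n c) = 0"
    by (simp add: diff_right rep_represents assms(2))
  then have "r - rep n c = 0" by (intro form_eq_0) simp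
  then show ?thesis by simp
qed

lemma poly_rep_0: "poly (rep n c) 0 * c = of_real (\<Sum>k\<le>n. (cmod (poly (\<phi> k) 0))\<^sup>2 * (cmod c)\<^sup>2)"
  by (simp add: rep_def poly_sum sum_distrib_left of_real_cmod_squared mult_ac)

text \<open>The linear term is 2 Re B(q, rep), and B(rep, rep) = rep(0) c by the representing
  property applied to \<open>rep\<close> itself.\<close>

lemma complete_square:
  assumes "degree q \<le> n"
  shows "Re (B q q) - 2 * Re (poly q 0 * c) =
    Re (B (q - rep n c) (q - rep n c)) - Re (poly (rep n c) 0 * c)"
proof -
  have "B (rep n c) q = cnj (poly q 0 * c)"
    by (subst hermitian) (simp add: rep_represents assms)
  then show ?thesis
    by (simp add: diff_left diff_right rep_represents assms degree_rep)
qed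

section \<open>The inverse of the Gram matrix\<close>

text \<open>Let C be the triangular matrix whose row m holds the coefficients of
  \<open>\<phi> m\<close>. Orthonormality says C M C* = 1, so the inverse of M is C* C, the
  coefficient matrix of the kernel.\<close>

lemma gram_inverse:
  assumes "M \<in> carrier_mat (n + 1) (n + 1)"
    and "\<And>j k. j \<le> n \<Longrightarrow> k \<le> n \<Longrightarrow> M $$ (j, k) = B (Polynomial.monom 1 j) (Polynomial.monom 1 k)"
  shows "mat_inverse M =
    Some (Matrix.mat (n + 1) (n + 1) (\<lambda>(k, l). \<Sum>m\<le>n. cnj (coeff (\<phi> m) k) * coeff (\<phi> m) l))"
    (is "_ = Some ?N")
proof -
  have N: "?N \<in> carrier_mat (n + 1) (n + 1)" by simp
  have right: "M * ?N = 1\<^sub>m (n + 1)"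
  proof (rule eq_matI)
    fix j l assume "j < dim_row (1\<^sub>m (n + 1) :: complex Matrix.mat)"
      and "l < dim_col (1\<^sub>m (n + 1) :: complex Matrix.mat)"
    then have jl: "j \<le> n" "l \<le> n" by auto
    \<comment> \<open>Padded with zero coefficients up to \<open>n\<close>, so that one index range
      serves every \<open>m\<close>.\<close>
    have phi: "\<phi> m = (\<Sum>k\<le>n. Polynomial.smult (coeff (\<phi> m) k) (Polynomial.monom 1 k))" if "m \<le> n" for m
      using poly_as_sum_of_monoms'[of "\<phi> m" n] that degree_phi[of m] by (simp add: smult_monom)
    have "(M * ?N) $$ (j, l) = (\<Sum>k<n + 1. M $$ (j, k) * ?N $$ (k, l))"
      using assms(1) jl by (simp add: scalar_prod_def lessThan_atLeast0)
    also have "\<dots> = (\<Sum>k\<le>n. M $$ (j, k) * ?N $$ (k, l))"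
      by (rule sum.cong) auto
    also have "\<dots> = (\<Sum>k\<le>n. \<Sum>m\<le>n. B (Polynomial.monom 1 j) (Polynomial.monom 1 k) * cnj (coeff (\<phi> m) k) * coeff (\<phi> m) l)"
      using jl by (intro sum.cong) (simp_all add: assms(2) sum_distrib_left mult_ac)
    also have "\<dots> = (\<Sum>m\<le>n. \<Sum>k\<le>n. B (Polynomial.monom 1 j) (Polynomial.monom 1 k) * cnj (coeff (\<phi> m) k) * coeff (\<phi> m) l)"
      by (rule sum.swap)
    also have "\<dots> = (\<Sum>m\<le>n. B (Polynomial.monom 1 j) (\<Sum>k\<le>n. Polynomial.smult (coeff (\<phi> m) k) (Polynomial.monom 1 k)) * coeff (\<phi> m) l)"
      unfolding sum_right smult_right sum_distrib_right by (simp add: mult_ac)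
    also have "\<dots> = (\<Sum>m\<le>n. B (Polynomial.monom 1 j) (\<phi> m) * coeff (\<phi> m) l)"
      using phi by (intro sum.cong) simp_all
    \<comment> \<open>The sum is the orthonormal expansion of z^j, whose z^l coefficient is the
      Kronecker delta.\<close>
    also have "\<dots> = coeff (\<Sum>m\<le>n. Polynomial.smult (B (Polynomial.monom 1 j) (\<phi> m)) (\<phi> m)) l"
      by (simp add: coeff_sum)
    also have "\<dots> = coeff (Polynomial.monom 1 j) l"
      using expansion[of "Polynomial.monom 1 j" n] jl by (simp add: degree_monom_eq)
    finally show "(M * ?N) $$ (j, l) = 1\<^sub>m (n + 1) $$ (j, l)"
      using jl by auto
  qed (use assms(1) in auto)
  have left: "?N * M = 1\<^sub>m (n + 1)"
    by (rule mat_mult_left_right_inverse[OF assms(1) N right])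
  \<comment> \<open>\<open>None\<close> would contradict the invertibility just shown, and any
    matrix returned is a left inverse, hence equal to the explicit one.\<close>
  show ?thesis
  proof (cases "mat_inverse M")
    case None
    have "M \<in> Units (ring_mat TYPE(complex) (n + 1) ())"
      using assms(1) N left right by (auto simp: Units_def ring_mat_def)
    with mat_inverse(1)[OF assms(1) None, of "()"] show ?thesis by blast
  next
    case (Some N')
    then have N': "N' \<in> carrier_mat (n + 1) (n + 1)" "N' * M = 1\<^sub>m (n + 1)"
      using mat_inverse(2)[OF assms(1)] by auto
    have "N' = N' * (M * ?N)"
      unfolding right by (rule right_mult_one_mat[OF N'(1), symmetric])
    also have "\<dots> = (N' * M) * ?N"
      by (rule assoc_mult_mat[OF N'(1) assms(1) N, symmetric])
    also have "\<dots> = ?N"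
      unfolding N'(2) by (rule left_mult_one_mat[OF N])
    finally show ?thesis using Some by simp
  qed
qed

section \<open>Leading coefficients and the reversed polynomial\<close>

text \<open>Among the \<open>\<phi> k\<close> with k \<le> n only \<open>\<phi> n\<close> has a z^n
  term, so pairing with it reads off a leading coefficient.\<close>

lemma form_phi:
  assumes "degree q \<le> n"
  shows "B q (\<phi> n) * coeff (\<phi> n) n = coeff q n"
proof -
  have "coeff q n = (\<Sum>k\<le>n. B q (\<phi> k) * coeff (\<phi> k) n)"
    by (subst expansion[OF assms]) (simp add: coeff_sum)
  also have "\<dots> = (\<Sum>k\<in>{n}. B q (\<phi> k) * coeff (\<phi> k) n)"
    by (rule sum.mono_neutral_right) (auto simp: degree_phi intro!: coeff_eq_0)
  finally show ?thesis by simp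
qed

text \<open>Invariance under multiplication by \<open>z\<close> makes the Gram matrix Toeplitz.\<close>

lemma rep_shift_invariant:
  assumes shift: "\<And>p q. B (pCons 0 p) (pCons 0 q) = B p q"
    and real: "coeff (\<phi> n) n \<in> \<real>"
  shows "poly (rep n c) 0 * c = (coeff (\<phi> n) n)\<^sup>2 * of_real ((cmod c)\<^sup>2)"
proof -
  define \<kappa> where "\<kappa> = coeff (\<phi> n) n"
  \<comment> \<open>The reversed polynomial of \<open>\<phi> n\<close>, with conjugated
    coefficients, scaled by cnj c and \<open>\<kappa>\<close>; the factor \<open>\<kappa>\<close>
    normalizes the pairing of 1 with \<open>r\<close> to c.\<close>
  define r where "r = (\<Sum>k\<le>n. Polynomial.smult (cnj (c * coeff (\<phi> n) (n - k)) * \<kappa>) (Polynomial.monom 1 k))"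
  have \<kappa>0: "\<kappa> \<noteq> 0"
    using phi_nonzero[of n] degree_phi[of n] by (metis leading_coeff_0_iff \<kappa>_def)
  have \<kappa>r: "cnj \<kappa> = \<kappa>" using real by (simp add: \<kappa>_def Reals_cnj_iff)
  have monom_shift: "B (Polynomial.monom 1 (i + m)) (Polynomial.monom 1 (j + m)) = B (Polynomial.monom 1 i) (Polynomial.monom 1 j)" for i j m
    by (induction m) (simp_all add: monom_Suc shift)
  \<comment> \<open>Both pairs of exponents have the difference j - k; each is shifted down until
    its smaller exponent is 0.\<close>
  have toeplitz: "B (Polynomial.monom 1 j) (Polynomial.monom 1 k) = B (Polynomial.monom 1 (n - k)) (Polynomial.monom 1 (n - j))"
    if "j \<le> n" "k \<le> n" for j k
    using monom_shift[of j "n - j" k] monom_shift[of "n - k" k "n - j"]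
      monom_shift[of 0 j "k - j"] monom_shift[of 0 "n - k" "k - j"]
      monom_shift[of "j - k" k 0] monom_shift[of "j - k" "n - j" 0] that
    by (cases "j \<le> k") auto
  have phi: "\<phi> n = (\<Sum>k\<le>n. Polynomial.smult (coeff (\<phi> n) (n - k)) (Polynomial.monom 1 (n - k)))"
  proof -
    have "\<phi> n = (\<Sum>k\<le>n. Polynomial.monom (coeff (\<phi> n) k) k)"
      using poly_as_sum_of_monoms'[of "\<phi> n" n] degree_phi[of n] by simp
    also have "\<dots> = (\<Sum>k\<le>n. Polynomial.monom (coeff (\<phi> n) (n - k)) (n - k))"
      using sum.nat_diff_reindex[of "\<lambda>k. Polynomial.monom (coeff (\<phi> n) k) k" "Suc n"]
      by (simp add: lessThan_Suc_atMost)
    finally show ?thesis by (simp add: smult_monom)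
  qed
  \<comment> \<open>Reflecting exponents turns the pairing of z^j with \<open>r\<close> into a
    conjugated pairing of z^(n-j) with \<open>\<phi> n\<close>, which by \<open>form_phi\<close>
    vanishes unless j = 0.\<close>
  have mono: "B (Polynomial.monom 1 j) r = poly (Polynomial.monom 1 j) 0 * c" if "j \<le> n" for j
  proof -
    have "B (Polynomial.monom 1 j) r = (\<Sum>k\<le>n. c * coeff (\<phi> n) (n - k) * \<kappa> * B (Polynomial.monom 1 j) (Polynomial.monom 1 k))"
      by (simp add: r_def sum_right smult_right \<kappa>r)
    also have "\<dots> = (\<Sum>k\<le>n. c * coeff (\<phi> n) (n - k) * \<kappa> * B (Polynomial.monom 1 (n - k)) (Polynomial.monom 1 (n - j)))"
      by (intro sum.cong) (simp_all only: toeplitz[OF that] atMost_iff)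
    also have "\<dots> = c * \<kappa> * B (\<Sum>k\<le>n. Polynomial.smult (coeff (\<phi> n) (n - k)) (Polynomial.monom 1 (n - k))) (Polynomial.monom 1 (n - j))"
      by (simp add: sum_left smult_left sum_distrib_left mult_ac)
    also have "\<dots> = c * cnj (B (Polynomial.monom 1 (n - j)) (\<phi> n) * \<kappa>)"
      using phi hermitian[of "\<phi> n"] \<kappa>r by simp
    also have "\<dots> = c * cnj (coeff (Polynomial.monom 1 (n - j)) n)"
      unfolding \<kappa>_def by (subst form_phi) (auto intro: order_trans[OF degree_monom_le])
    also have "\<dots> = poly (Polynomial.monom 1 j) 0 * c"
      using that by (auto simp: poly_monom power_0_left)
    finally show ?thesis .
  qed
  have "r = rep n c"
  proof (rule rep_unique)
    show "degree r \<le> n"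
      unfolding r_def
      by (intro degree_sum_le) (auto intro!: order_trans[OF degree_smult_le] order_trans[OF degree_monom_le])
  next
    fix q :: "complex poly" assume "degree q \<le> n"
    then have q: "q = (\<Sum>k\<le>n. Polynomial.smult (coeff q k) (Polynomial.monom 1 k))"
      using poly_as_sum_of_monoms'[of q n] by (simp add: smult_monom)
    have "B q r = (\<Sum>k\<le>n. coeff q k * B (Polynomial.monom 1 k) r)"
      by (subst q) (simp add: sum_left smult_left)
    also have "\<dots> = (\<Sum>k\<le>n. coeff q k * poly (Polynomial.monom 1 k) 0) * c"
      by (simp add: mono sum_distrib_left mult_ac)
    also have "(\<Sum>k\<le>n. coeff q k * poly (Polynomial.monom 1 k) 0) = poly q 0"
      by (subst (2) q) (simp add: poly_sum)
    finally show "B q r = poly q 0 * c" .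
  qed
  moreover have "poly r 0 = (\<Sum>k\<in>{0}. cnj (c * coeff (\<phi> n) (n - k)) * \<kappa> * poly (Polynomial.monom 1 k) 0)"
    unfolding r_def poly_sum poly_smult
    by (rule sum.mono_neutral_right) (auto simp: poly_monom)
  ultimately show ?thesis
    using \<kappa>r by (simp add: \<kappa>_def poly_monom power2_eq_square of_real_cmod_squared[unfolded power2_eq_square])
qed

end

section \<open>Weighted inner product of coefficient sequences\<close>

text \<open>Dirichlet notions see a function only through its Taylor coefficients; on power series,
  multiplication by a polynomial is plain ring multiplication.\<close>

definition wsummable :: "real \<Rightarrow> complex fps \<Rightarrow> bool" where
  "wsummable \<alpha> F \<longleftrightarrow> summable (\<lambda>k. (real k + 1) powr \<alpha> * (cmod (fps_nth F k))\<^sup>2)"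

definition fps_inner :: "real \<Rightarrow> complex fps \<Rightarrow> complex fps \<Rightarrow> complex" where
  "fps_inner \<alpha> F G = (\<Sum>k. of_real ((real k + 1) powr \<alpha>) * fps_nth F k * cnj (fps_nth G k))"

section \<open>Closure of the weighted sequence space, and convergence of the inner product\<close>

lemma wsummable_add:
  assumes "wsummable \<alpha> F" and "wsummable \<alpha> G"
  shows "wsummable \<alpha> (F + G)"
  unfolding wsummable_def
proof (rule summable_comparison_test')
  show "summable (\<lambda>k. 2 * ((real k + 1) powr \<alpha> * (cmod (fps_nth F k))\<^sup>2)
      + 2 * ((real k + 1) powr \<alpha> * (cmod (fps_nth G k))\<^sup>2))"
    using assms unfolding wsummable_def by (intro summable_add summable_mult)
  fix k
  have "(cmod (fps_nth F k + fps_nth G k))\<^sup>2 \<le> (cmod (fps_nth F k) + cmod (fps_nth G k))\<^sup>2"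
    by (intro power_mono norm_triangle_ineq) auto
  also have "\<dots> \<le> 2 * (cmod (fps_nth F k))\<^sup>2 + 2 * (cmod (fps_nth G k))\<^sup>2"
    using sum_squares_bound[of "cmod (fps_nth F k)" "cmod (fps_nth G k)"]
    by (simp add: power2_sum)
  finally have "(real k + 1) powr \<alpha> * (cmod (fps_nth F k + fps_nth G k))\<^sup>2
    \<le> (real k + 1) powr \<alpha> * (2 * (cmod (fps_nth F k))\<^sup>2 + 2 * (cmod (fps_nth G k))\<^sup>2)"
    by (intro mult_left_mono) auto
  then show "norm ((real k + 1) powr \<alpha> * (cmod (fps_nth (F + G) k))\<^sup>2)
    \<le> 2 * ((real k + 1) powr \<alpha> * (cmod (fps_nth F k))\<^sup>2)
      + 2 * ((real k + 1) powr \<alpha> * (cmod (fps_nth G k))\<^sup>2)"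
    by (simp add: algebra_simps)
qed

lemma wsummable_const_mult:
  assumes "wsummable \<alpha> F"
  shows "wsummable \<alpha> (fps_const c * F)"
  using summable_mult[OF assms[unfolded wsummable_def], of "(cmod c)\<^sup>2"]
  by (simp add: wsummable_def norm_mult power_mult_distrib mult_ac)

text \<open>Consecutive weights have ratio ((k+2)/(k+1))^\<alpha>, which is at most 2^|\<alpha>| for
  either sign of \<alpha>, so the shift is bounded.\<close>

lemma wsummable_X_mult:
  assumes "wsummable \<alpha> F"
  shows "wsummable \<alpha> (fps_X * F)"
proof -
  have "summable (\<lambda>k. (real (Suc k) + 1) powr \<alpha> * (cmod (fps_nth (fps_X * F) (Suc k)))\<^sup>2)"
  proof (rule summable_comparison_test')
    show "summable (\<lambda>k. 2 powr \<bar>\<alpha>\<bar> * ((real k + 1) powr \<alpha> * (cmod (fps_nth F k))\<^sup>2))"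
      using assms unfolding wsummable_def by (rule summable_mult)
    fix k
    define t where "t = (real k + 2) / (real k + 1)"
    have t: "1 \<le> t" "t \<le> 2" by (simp_all add: t_def field_simps)
    have "(real k + 2) powr \<alpha> = t powr \<alpha> * (real k + 1) powr \<alpha>"
      using t by (subst powr_mult[symmetric]) (auto simp: t_def)
    moreover have "t powr \<alpha> \<le> 2 powr \<bar>\<alpha>\<bar>"
    proof -
      have "t powr \<alpha> \<le> t powr \<bar>\<alpha>\<bar>" using t by (intro powr_mono) auto
      also have "\<dots> \<le> 2 powr \<bar>\<alpha>\<bar>" using t by (intro powr_mono2) auto
      finally show ?thesis .
    qed
    ultimately have "(real k + 2) powr \<alpha> \<le> 2 powr \<bar>\<alpha>\<bar> * (real k + 1) powr \<alpha>"
      by (simp add: mult_right_mono)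
    then have "(real k + 2) powr \<alpha> * (cmod (fps_nth F k))\<^sup>2
      \<le> 2 powr \<bar>\<alpha>\<bar> * (real k + 1) powr \<alpha> * (cmod (fps_nth F k))\<^sup>2"
      by (intro mult_right_mono) auto
    then show "norm ((real (Suc k) + 1) powr \<alpha> * (cmod (fps_nth (fps_X * F) (Suc k)))\<^sup>2)
      \<le> 2 powr \<bar>\<alpha>\<bar> * ((real k + 1) powr \<alpha> * (cmod (fps_nth F k))\<^sup>2)"
      by (simp add: add_ac mult_ac)
  qed
  then show ?thesis
    unfolding wsummable_def by (subst (asm) summable_Suc_iff)
qed

text \<open>Horner recursion a + z p reduces this to scalars, sums and the shift.\<close>

lemma wsummable_poly_mult:
  assumes "wsummable \<alpha> F"
  shows "wsummable \<alpha> (fps_of_poly p * F)"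
proof (induction p)
  case 0
  then show ?case by (simp add: wsummable_def)
next
  case (pCons a p)
  have "fps_of_poly (pCons a p) * F = fps_const a * F + fps_X * (fps_of_poly p * F)"
    by (simp add: fps_of_poly_pCons algebra_simps)
  then show ?case
    using pCons.IH assms by (simp add: wsummable_add wsummable_const_mult wsummable_X_mult)
qed

lemma wsummable_1: "wsummable \<alpha> 1"
  unfolding wsummable_def
  by (rule summable_finite[of "{0}"]) auto

text \<open>Absolute convergence follows from |ab| \<le> |a|^2 + |b|^2; it is what allows
  \<open>suminf\<close> to be split in the linearity lemmas.\<close>

lemma wsummable_inner:
  assumes "wsummable \<alpha> F" and "wsummable \<alpha> G"
  shows "summable (\<lambda>k. of_real ((real k + 1) powr \<alpha>) * fps_nth F k * cnj (fps_nth G k))"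
proof (rule summable_comparison_test')
  show "summable (\<lambda>k. (real k + 1) powr \<alpha> * (cmod (fps_nth F k))\<^sup>2
      + (real k + 1) powr \<alpha> * (cmod (fps_nth G k))\<^sup>2)"
    using assms unfolding wsummable_def by (rule summable_add)
  fix k
  have "cmod (fps_nth F k) * cmod (fps_nth G k) \<le> (cmod (fps_nth F k))\<^sup>2 + (cmod (fps_nth G k))\<^sup>2"
    using sum_squares_bound[of "cmod (fps_nth F k)" "cmod (fps_nth G k)"]
      mult_nonneg_nonneg[of "cmod (fps_nth F k)" "cmod (fps_nth G k)"]
    by (simp del: mult_nonneg_nonneg)
  then have "(real k + 1) powr \<alpha> * (cmod (fps_nth F k) * cmod (fps_nth G k))
    \<le> (real k + 1) powr \<alpha> * ((cmod (fps_nth F k))\<^sup>2 + (cmod (fps_nth G k))\<^sup>2)"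
    by (intro mult_left_mono) auto
  then show "norm (of_real ((real k + 1) powr \<alpha>) * fps_nth F k * cnj (fps_nth G k))
    \<le> (real k + 1) powr \<alpha> * (cmod (fps_nth F k))\<^sup>2 + (real k + 1) powr \<alpha> * (cmod (fps_nth G k))\<^sup>2"
    by (simp add: norm_mult algebra_simps)
qed

section \<open>Algebra of the inner product of power series\<close>

lemma fps_inner_add_left:
  assumes "wsummable \<alpha> F" and "wsummable \<alpha> G" and "wsummable \<alpha> H"
  shows "fps_inner \<alpha> (F + G) H = fps_inner \<alpha> F H + fps_inner \<alpha> G H"
  unfolding fps_inner_def
  by (subst suminf_add[OF wsummable_inner[OF assms(1,3)] wsummable_inner[OF assms(2,3)]])
    (simp add: algebra_simps)

lemma fps_inner_const_mult_left:
  assumes "wsummable \<alpha> F" and "wsummable \<alpha> G"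
  shows "fps_inner \<alpha> (fps_const c * F) G = c * fps_inner \<alpha> F G"
  unfolding fps_inner_def
  by (subst suminf_mult[OF wsummable_inner[OF assms], symmetric]) (simp add: mult_ac)

lemma fps_inner_hermitian:
  assumes "wsummable \<alpha> F" and "wsummable \<alpha> G"
  shows "fps_inner \<alpha> F G = cnj (fps_inner \<alpha> G F)"
proof -
  have "(\<lambda>k. of_real ((real k + 1) powr \<alpha>) * fps_nth G k * cnj (fps_nth F k)) sums fps_inner \<alpha> G F"
    unfolding fps_inner_def using wsummable_inner[OF assms(2,1)] by (rule summable_sums)
  then have "(\<lambda>k. cnj (of_real ((real k + 1) powr \<alpha>) * fps_nth G k * cnj (fps_nth F k)))
      sums cnj (fps_inner \<alpha> G F)"
    by (simp only: sums_cnj)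
  then show ?thesis
    unfolding fps_inner_def[of \<alpha> F G] by (intro sums_unique[symmetric]) (simp add: mult_ac)
qed

text \<open>The weight at index 0 is 1 for every \<alpha>, so approximating the constant 1 is a
  question about values at 0.\<close>

lemma fps_inner_1_right: "fps_inner \<alpha> F 1 = fps_nth F 0"
proof -
  have "fps_inner \<alpha> F 1 =
      (\<Sum>k\<in>{0}. of_real ((real k + 1) powr \<alpha>) * fps_nth F k * cnj (fps_nth 1 k))"
    unfolding fps_inner_def by (rule suminf_finite) auto
  then show ?thesis by simp
qed

text \<open>For \<alpha> = 0 all weights are 1 and the product with z has constant term 0, so only
  the index moves.\<close>

lemma fps_inner_X_mult:
  assumes "wsummable 0 F" and "wsummable 0 G"
  shows "fps_inner 0 (fps_X * F) (fps_X * G) = fps_inner 0 F G"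
proof -
  have "(\<Sum>k. of_real ((real (Suc k) + 1) powr 0) * fps_nth (fps_X * F) (Suc k)
      * cnj (fps_nth (fps_X * G) (Suc k))) = fps_inner 0 (fps_X * F) (fps_X * G)"
    unfolding fps_inner_def
    by (subst suminf_split_head[OF wsummable_inner[OF wsummable_X_mult[OF assms(1)]
            wsummable_X_mult[OF assms(2)]]]) simp
  then show ?thesis by (simp add: fps_inner_def)
qed

lemma fps_inner_self:
  assumes "wsummable \<alpha> F"
  shows "fps_inner \<alpha> F F = of_real (\<Sum>k. (real k + 1) powr \<alpha> * (cmod (fps_nth F k))\<^sup>2)"
proof -
  have "of_real (\<Sum>k. (real k + 1) powr \<alpha> * (cmod (fps_nth F k))\<^sup>2) =
      (\<Sum>k. complex_of_real ((real k + 1) powr \<alpha> * (cmod (fps_nth F k))\<^sup>2))"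
    using assms unfolding wsummable_def by (rule suminf_of_real)
  also have "\<dots> = fps_inner \<alpha> F F"
    by (simp add: fps_inner_def of_real_cmod_squared mult.assoc)
  finally show ?thesis by simp
qed

lemma fps_inner_diff_1:
  assumes "wsummable \<alpha> F"
  shows "Re (fps_inner \<alpha> (F - 1) (F - 1)) = Re (fps_inner \<alpha> F F) - 2 * Re (fps_nth F 0) + 1"
proof -
  \<comment> \<open>The constant -1 written as a scalar multiple of 1, so that the difference
    expands by the laws for sums and scalars.\<close>
  define U :: "complex fps" where "U = fps_const (-1) * 1"
  have U: "wsummable \<alpha> U"
    unfolding U_def by (rule wsummable_const_mult[OF wsummable_1])
  have FU: "wsummable \<alpha> (F + U)"
    using assms U by (rule wsummable_add)
  have inner_U: "fps_inner \<alpha> G U = - fps_nth G 0" if "wsummable \<alpha> G" for G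
    using fps_inner_hermitian[OF that U] fps_inner_hermitian[OF that wsummable_1]
    by (simp add: U_def fps_inner_const_mult_left[OF wsummable_1 that] fps_inner_1_right
        del: mult_1_right)
  have "fps_inner \<alpha> (F + U) (F + U) =
      cnj (fps_inner \<alpha> F F) + cnj (fps_inner \<alpha> U F) + (1 - cnj (fps_nth F 0))"
    using fps_inner_add_left[OF assms U FU] fps_inner_hermitian[OF assms FU]
      fps_inner_hermitian[OF U FU] fps_inner_add_left[OF assms U assms]
      fps_inner_add_left[OF assms U U] inner_U[OF assms] inner_U[OF U]
    by (simp add: U_def)
  moreover have "F + U = F - 1" by (simp add: U_def fps_const_neg[symmetric] del: fps_const_neg)
  ultimately show ?thesis
    using fps_inner_hermitian[OF U assms] inner_U[OF assms] by simp
qed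

section \<open>Functions on the disc\<close>

lemma taylor_coeff_eq:
  assumes "g has_fps_expansion G"
  shows "taylor_coeff g = fps_nth G"
  using fps_expansion_eqI[OF assms] by (auto simp: taylor_coeff_def fun_eq_iff)

lemma dirichlet_inner_eq:
  assumes "g has_fps_expansion G" and "h has_fps_expansion H"
  shows "dirichlet_inner \<alpha> g h = fps_inner \<alpha> G H"
  by (simp add: dirichlet_inner_def fps_inner_def taylor_coeff_eq[OF assms(1)]
      taylor_coeff_eq[OF assms(2)])

lemma dirichlet_norm_nonneg:
  assumes "g has_fps_expansion G" and "wsummable \<alpha> G"
  shows "dirichlet_norm \<alpha> g \<ge> 0"
  using assms(2) unfolding dirichlet_norm_def taylor_coeff_eq[OF assms(1)] wsummable_def
  by (intro real_sqrt_ge_zero suminf_nonneg) auto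

lemma dirichlet_norm_eq:
  assumes "g has_fps_expansion G" and "wsummable \<alpha> G"
  shows "(dirichlet_norm \<alpha> g)\<^sup>2 = Re (fps_inner \<alpha> G G)"
  using dirichlet_norm_nonneg[OF assms]
  by (simp add: dirichlet_norm_def taylor_coeff_eq[OF assms(1)] fps_inner_self[OF assms(2)])

lemma has_fps_expansion_poly: "poly p has_fps_expansion fps_of_poly p" for p :: "complex poly"
proof -
  have "eval_fps (fps_of_poly p) has_fps_expansion fps_of_poly p"
    by (rule eval_fps_has_fps_expansion) simp
  then show ?thesis by (simp add: eval_fps_of_poly[abs_def])
qed

context
  fixes \<alpha> :: real and f :: "complex \<Rightarrow> complex"
  assumes f: "f \<in> dirichlet_space \<alpha>"
begin

section \<open>Polynomial multiples of a fixed function in the space\<close>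

lemma poly_mult_expansion:
  "(\<lambda>z. poly q z * f z) has_fps_expansion fps_of_poly q * fps_expansion f 0"
proof -
  have "f analytic_on {0}"
    using f by (auto simp: dirichlet_space_def intro: analytic_on_subset)
  then have "f has_fps_expansion fps_expansion f 0"
    by (simp add: analytic_at_imp_has_fps_expansion_0)
  then show ?thesis
    by (intro has_fps_expansion_mult has_fps_expansion_poly)
qed

lemma wsummable_expansion: "wsummable \<alpha> (fps_of_poly q * fps_expansion f 0)"
  using f by (intro wsummable_poly_mult) (simp add: dirichlet_space_def wsummable_def taylor_coeff_def)

lemma weighted_inner_eq: "weighted_inner \<alpha> f (poly p) (poly q) =
    fps_inner \<alpha> (fps_of_poly p * fps_expansion f 0) (fps_of_poly q * fps_expansion f 0)"
  unfolding weighted_inner_def by (intro dirichlet_inner_eq poly_mult_expansion)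

lemma orthonormal_polys_weighted_inner:
  assumes "is_orthogonal_polynomials \<alpha> f \<phi>"
  shows "orthonormal_polys (\<lambda>p q. weighted_inner \<alpha> f (poly p) (poly q)) \<phi>"
proof
  fix p q r :: "complex poly" and c k j
  note W = wsummable_expansion
  show "weighted_inner \<alpha> f (poly (p + q)) (poly r) =
      weighted_inner \<alpha> f (poly p) (poly r) + weighted_inner \<alpha> f (poly q) (poly r)"
    using fps_inner_add_left[OF W[of p] W[of q] W[of r]]
    by (simp only: weighted_inner_eq fps_of_poly_add distrib_right)
  show "weighted_inner \<alpha> f (poly (Polynomial.smult c p)) (poly r) =
      c * weighted_inner \<alpha> f (poly p) (poly r)"
    using fps_inner_const_mult_left[OF W[of p] W[of r], of c]
    by (simp only: weighted_inner_eq fps_of_poly_smult mult.assoc)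
  show "weighted_inner \<alpha> f (poly p) (poly q) = cnj (weighted_inner \<alpha> f (poly q) (poly p))"
    unfolding weighted_inner_eq by (intro fps_inner_hermitian W)
  show "degree (\<phi> k) = k"
    using assms by (simp add: is_orthogonal_polynomials_def)
  have "Re (lead_coeff (\<phi> k)) > 0"
    using assms unfolding is_orthogonal_polynomials_def by blast
  then show "\<phi> k \<noteq> 0" by auto
  show "weighted_inner \<alpha> f (poly (\<phi> k)) (poly (\<phi> j)) = (if k = j then 1 else 0)"
    using assms by (simp add: is_orthogonal_polynomials_def)
qed

lemma poly_mult_diff_1_expansion:
  "(\<lambda>z. poly q z * f z - 1) has_fps_expansion fps_of_poly q * fps_expansion f 0 - 1"
  by (intro has_fps_expansion_diff poly_mult_expansion has_fps_expansion_1)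

lemma wsummable_diff_1_expansion: "wsummable \<alpha> (fps_of_poly q * fps_expansion f 0 - 1)"
  using wsummable_add[OF wsummable_expansion wsummable_const_mult[OF wsummable_1], of q "-1"]
  by (simp flip: fps_const_neg)

lemma dirichlet_norm_poly_mult_diff_1_nonneg:
  "dirichlet_norm \<alpha> (\<lambda>z. poly q z * f z - 1) \<ge> 0"
  by (rule dirichlet_norm_nonneg[OF poly_mult_diff_1_expansion wsummable_diff_1_expansion])

text \<open>The cross term is the inner product of q f with 1, that is q(0) f(0). This is the
  expression to which \<open>complete_square\<close> applies.\<close>

lemma dirichlet_norm_poly_mult_diff_1:
  "(dirichlet_norm \<alpha> (\<lambda>z. poly q z * f z - 1))\<^sup>2 =
    Re (weighted_inner \<alpha> f (poly q) (poly q)) - 2 * Re (poly q 0 * f 0) + 1"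
proof -
  have "poly q 0 * f 0 = fps_nth (fps_of_poly q * fps_expansion f 0) 0"
    by (rule has_fps_expansion_imp_0_eq_fps_nth_0[OF poly_mult_expansion])
  then show ?thesis
    unfolding dirichlet_norm_eq[OF poly_mult_diff_1_expansion wsummable_diff_1_expansion]
      fps_inner_diff_1[OF wsummable_expansion] weighted_inner_eq by simp
qed

text \<open>Taylor coefficients depend only on the germ at 0, so agreement on the disc suffices; the
  change of sign leaves their moduli alone.\<close>

lemma dirichlet_norm_1_diff:
  assumes "\<And>z. z \<in> ball 0 1 \<Longrightarrow> h z = poly q z * f z"
  shows "dirichlet_norm \<alpha> (\<lambda>z. 1 - h z) = dirichlet_norm \<alpha> (\<lambda>z. poly q z * f z - 1)"
proof -
  note E = poly_mult_expansion[of q]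
  let ?G = "fps_of_poly q * fps_expansion f 0"
  have "(\<lambda>z. 1 - poly q z * f z) has_fps_expansion 1 - ?G"
    by (intro has_fps_expansion_diff E has_fps_expansion_1)
  moreover have "eventually (\<lambda>z. z \<in> ball 0 1) (nhds (0 :: complex))"
    by (rule eventually_nhds_in_open) auto
  then have "eventually (\<lambda>z. 1 - h z = 1 - poly q z * f z) (nhds 0)"
    by eventually_elim (simp add: assms)
  ultimately have "(\<lambda>z. 1 - h z) has_fps_expansion 1 - ?G"
    by (subst has_fps_expansion_cong) auto
  then show ?thesis
    using poly_mult_diff_1_expansion[of q]
    by (simp add: dirichlet_norm_def taylor_coeff_eq norm_minus_commute)
qed

lemma weighted_inner_shift:
  assumes "\<alpha> = 0"
  shows "weighted_inner \<alpha> f (poly (pCons 0 p)) (poly (pCons 0 q)) =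
    weighted_inner \<alpha> f (poly p) (poly q)"
proof -
  have shift: "fps_of_poly (pCons 0 q) * fps_expansion f 0 =
      fps_X * (fps_of_poly q * fps_expansion f 0)" for q
    by (simp add: fps_of_poly_pCons mult_ac)
  show ?thesis
    using fps_inner_X_mult[of "fps_of_poly p * fps_expansion f 0" "fps_of_poly q * fps_expansion f 0"]
      wsummable_expansion[of p] wsummable_expansion[of q] assms
    unfolding weighted_inner_eq shift by simp
qed

text \<open>The multiple given by \<open>p\<close> shows that the set is nonempty and attains the
  bound, while optimality gives the lower bound that a real infimum requires.\<close>

lemma dirichlet_dist_attained:
  assumes "is_optimal_approximant \<alpha> f n p"
  shows "dirichlet_dist \<alpha> (\<lambda>z. 1) (poly_multiples f n) = dirichlet_norm \<alpha> (\<lambda>z. poly p z * f z - 1)"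
  unfolding dirichlet_dist_def
proof (rule antisym)
  let ?N = "\<lambda>h. dirichlet_norm \<alpha> (\<lambda>z. 1 - h z)"
  have p: "(\<lambda>z. poly p z * f z) \<in> poly_multiples f n"
    using assms by (auto simp: is_optimal_approximant_def poly_multiples_def)
  have lower: "dirichlet_norm \<alpha> (\<lambda>z. poly p z * f z - 1) \<le> ?N h" if "h \<in> poly_multiples f n" for h
  proof -
    obtain q where q: "degree q \<le> n" "\<And>z. z \<in> ball 0 1 \<Longrightarrow> h z = poly q z * f z"
      using \<open>h \<in> poly_multiples f n\<close> by (auto simp: poly_multiples_def)
    show ?thesis
      using assms q(1) dirichlet_norm_1_diff[OF q(2)] by (simp add: is_optimal_approximant_def)
  qed
  show "(INF h\<in>poly_multiples f n. ?N h) \<le> dirichlet_norm \<alpha> (\<lambda>z. poly p z * f z - 1)"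
    using lower dirichlet_norm_1_diff[of "\<lambda>z. poly p z * f z" p]
    by (intro cINF_lower2[OF _ p] bdd_belowI2) auto
  show "dirichlet_norm \<alpha> (\<lambda>z. poly p z * f z - 1) \<le> (INF h\<in>poly_multiples f n. ?N h)"
    using p lower by (intro cINF_greatest) auto
qed

text \<open>A kernel section is a polynomial multiple of \<open>f\<close> on the disc only; its germ
  at 0 is enough.\<close>

lemma dirichlet_inner_cong_right:
  assumes "\<And>z. z \<in> ball 0 1 \<Longrightarrow> h z = poly q z * f z"
  shows "dirichlet_inner \<alpha> g h = dirichlet_inner \<alpha> g (\<lambda>z. poly q z * f z)"
proof -
  have "eventually (\<lambda>z. z \<in> ball 0 1) (nhds (0 :: complex))"
    by (rule eventually_nhds_in_open) auto
  then have "eventually (\<lambda>z. h z = poly q z * f z) (nhds 0)"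
    by eventually_elim (simp add: assms)
  then have "fps_expansion h 0 = fps_expansion (\<lambda>z. poly q z * f z) 0"
    by (rule fps_expansion_cong)
  then show ?thesis by (simp add: dirichlet_inner_def taylor_coeff_def)
qed

end

section \<open>Reduction of all quantities to one number\<close>

theorem corollary5p3:
  fixes \<alpha> :: real and f :: "complex \<Rightarrow> complex" and n :: nat
    and p :: "complex poly" and \<phi> :: "nat \<Rightarrow> complex poly"
    and K :: "complex \<Rightarrow> complex \<Rightarrow> complex"
  assumes "f \<in> dirichlet_space \<alpha>" and "f 0 \<noteq> 0"
    and "is_optimal_approximant \<alpha> f n p"
    and "is_orthogonal_polynomials \<alpha> f \<phi>"
    and "is_reproducing_kernel \<alpha> (poly_multiples f n) K"
  shows "let d = complex_of_real ((dirichlet_dist \<alpha> (\<lambda>z. 1) (poly_multiples f n))\<^sup>2) in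
      d = complex_of_real ((dirichlet_norm \<alpha> (\<lambda>z. poly p z * f z - 1))\<^sup>2) \<and>
      d = 1 - poly p 0 * f 0 \<and>
      (\<exists>N. mat_inverse (gram_matrix \<alpha> f n) = Some N \<and>
        d = 1 - N $$ (0, 0) * complex_of_real ((cmod (f 0))\<^sup>2)) \<and>
      d = complex_of_real (1 - (\<Sum>k=0..n. (cmod (poly (\<phi> k) 0))\<^sup>2 * (cmod (f 0))\<^sup>2)) \<and>
      d = 1 - K 0 0 \<and>
      (\<alpha> = 0 \<and> degree p = n \<longrightarrow>
        d = 1 - (coeff (\<phi> n) n)\<^sup>2 * complex_of_real ((cmod (f 0))\<^sup>2))"
proof -
  define B where "B = (\<lambda>p q. weighted_inner \<alpha> f (poly p) (poly q))"
  interpret orthonormal_polys B \<phi>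
    unfolding B_def using assms(1,4) by (rule orthonormal_polys_weighted_inner)
  \<comment> \<open>Each quantity will be shown to equal 1 - s.\<close>
  define s where "s = (\<Sum>k\<le>n. (cmod (poly (\<phi> k) 0))\<^sup>2 * (cmod (f 0))\<^sup>2)"
  define ps where "ps = rep n (f 0)"
  have ps0: "poly ps 0 * f 0 = of_real s"
    unfolding ps_def s_def by (rule poly_rep_0)
  \<comment> \<open>Since the form is positive definite, the squared error is smallest exactly at q
    = \<open>ps\<close>, with minimum 1 - s.\<close>
  have norm_sq: "(dirichlet_norm \<alpha> (\<lambda>z. poly q z * f z - 1))\<^sup>2 =
      Re (B (q - ps) (q - ps)) + (1 - s)" if "degree q \<le> n" for q
    using complete_square[OF that, of "f 0"] ps0
    unfolding dirichlet_norm_poly_mult_diff_1[OF assms(1)] ps_def B_def by simp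
  have p: "degree p \<le> n"
    and min: "\<And>q. degree q \<le> n \<Longrightarrow>
      dirichlet_norm \<alpha> (\<lambda>z. poly p z * f z - 1) \<le> dirichlet_norm \<alpha> (\<lambda>z. poly q z * f z - 1)"
    using assms(3) by (auto simp: is_optimal_approximant_def)
  \<comment> \<open>The optimal approximant is compared with the competitor \<open>ps\<close>; norms
    are nonnegative, so the comparison survives squaring.\<close>
  have "(dirichlet_norm \<alpha> (\<lambda>z. poly p z * f z - 1))\<^sup>2 \<le>
      (dirichlet_norm \<alpha> (\<lambda>z. poly ps z * f z - 1))\<^sup>2"
    using min[of ps] degree_rep[of n "f 0"]
    by (intro power_mono dirichlet_norm_poly_mult_diff_1_nonneg assms(1)) (simp add: ps_def)
  then have "Re (B (p - ps) (p - ps)) \<le> 0"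
    using norm_sq[OF p] norm_sq[of ps] degree_rep[of n "f 0"] by (simp add: ps_def)
  then have "p - ps = 0" by (rule form_eq_0)
  then have p_ps: "p = ps" by simp
  have dist: "dirichlet_dist \<alpha> (\<lambda>z. 1) (poly_multiples f n) =
      dirichlet_norm \<alpha> (\<lambda>z. poly p z * f z - 1)"
    using assms(1,3) by (rule dirichlet_dist_attained)
  have d: "(dirichlet_dist \<alpha> (\<lambda>z. 1) (poly_multiples f n))\<^sup>2 = 1 - s"
    unfolding dist norm_sq[OF p] by (simp add: p_ps)
  \<comment> \<open>The section at w = 0 is r f on the disc, and reproduction at 0 says that
    \<open>r\<close> represents q -> q(0) f(0); uniqueness gives r = \<open>ps\<close>.\<close>
  have kernel: "K 0 0 = of_real s"
  proof -
    have "(\<lambda>z. K z 0) \<in> poly_multiples f n"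
      and K: "\<And>g. g \<in> poly_multiples f n \<Longrightarrow> g 0 = dirichlet_inner \<alpha> g (\<lambda>z. K z 0)"
      using assms(5) by (auto simp: is_reproducing_kernel_def)
    then obtain r where r: "degree r \<le> n" "\<And>z. z \<in> ball 0 1 \<Longrightarrow> K z 0 = poly r z * f z"
      by (auto simp: poly_multiples_def)
    have "r = rep n (f 0)"
    proof (rule rep_unique[OF r(1)])
      fix q :: "complex poly" assume "degree q \<le> n"
      then have "poly q 0 * f 0 = dirichlet_inner \<alpha> (\<lambda>z. poly q z * f z) (\<lambda>z. K z 0)"
        by (intro K) (auto simp: poly_multiples_def)
      also have "\<dots> = B q r"
        unfolding B_def weighted_inner_def by (rule dirichlet_inner_cong_right[OF assms(1) r(2)])
      finally show "B q r = poly q 0 * f 0" by simp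
    qed
    then show ?thesis using r(2)[of 0] ps0 by (simp add: ps_def)
  qed
  have gram: "mat_inverse (gram_matrix \<alpha> f n) =
      Some (Matrix.mat (n + 1) (n + 1) (\<lambda>(k, l). \<Sum>m\<le>n. cnj (coeff (\<phi> m) k) * coeff (\<phi> m) l))"
    by (rule gram_inverse)
      (simp_all add: gram_matrix_def B_def weighted_inner_def poly_monom)
  \<comment> \<open>The (0,0) entry of the inverse is the sum of |\<phi>_m(0)|^2.\<close>
  have gram_00: "(\<Sum>m\<le>n. cnj (coeff (\<phi> m) 0) * coeff (\<phi> m) 0) * of_real ((cmod (f 0))\<^sup>2) = of_real s"
    by (simp add: s_def sum_distrib_left poly_0_coeff_0 of_real_cmod_squared mult_ac)
  \<comment> \<open>For \<alpha> = 0 the representative is also a multiple of the reversed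
    \<open>\<phi> n\<close>; evaluating both forms at 0 gives the identity.\<close>
  have last: "(coeff (\<phi> n) n)\<^sup>2 * of_real ((cmod (f 0))\<^sup>2) = of_real s" if "\<alpha> = 0"
  proof -
    have "coeff (\<phi> n) n \<in> \<real>"
      using assms(4) unfolding is_orthogonal_polynomials_def by metis
    then have "poly ps 0 * f 0 = (coeff (\<phi> n) n)\<^sup>2 * of_real ((cmod (f 0))\<^sup>2)"
      unfolding ps_def
      by (intro rep_shift_invariant) (simp_all add: B_def weighted_inner_shift[OF assms(1) that])
    then show ?thesis using ps0 by simp
  qed
  show ?thesis
    unfolding Let_def d
  proof (intro conjI impI)
    show "complex_of_real (1 - s) =
        complex_of_real ((dirichlet_norm \<alpha> (\<lambda>z. poly p z * f z - 1))\<^sup>2)"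
      using d dist by simp
    show "complex_of_real (1 - s) = 1 - poly p 0 * f 0"
      using ps0 p_ps by simp
    show "\<exists>N. mat_inverse (gram_matrix \<alpha> f n) = Some N \<and>
        complex_of_real (1 - s) = 1 - N $$ (0, 0) * complex_of_real ((cmod (f 0))\<^sup>2)"
      unfolding gram using gram_00 by simp
    show "complex_of_real (1 - s) =
        complex_of_real (1 - (\<Sum>k = 0..n. (cmod (poly (\<phi> k) 0))\<^sup>2 * (cmod (f 0))\<^sup>2))"
      by (simp add: s_def atLeast0AtMost)
    show "complex_of_real (1 - s) = 1 - K 0 0"
      using kernel by simp
    show "complex_of_real (1 - s) = 1 - (coeff (\<phi> n) n)\<^sup>2 * complex_of_real ((cmod (f 0))\<^sup>2)"
      if "\<alpha> = 0 \<and> degree p = n"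
      using last that by simp
  qed
qed

end
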